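(* Let $K$ be an arbitrary field, let $p_1,\dots,p_m,q_1,\dots,q_k\in K[x_1,\dots,x_n]$. The algebras $K[x_1,\dots,x_n]/\langle p_1,\dots,p_m\rangle$ and $K[x_1,\dots,x_n]/\langle q_1,\dots,q_k\rangle$ are isomorphic (as $K$-algebras) if and only if one can get from one of them to the other by a finite sequence of transformations of types (P1), (P2), (P3). In particular, two algebraic varieties $V(p_1,\dots,p_m)$ and $V(q_1,\dots,q_k)$ in $\mathbf{C}^n$ are isomorphic if and only if one can get from the algebra $\mathbf{C}[x_1,\dots,x_n]/\langle p_1,\dots,p_m\rangle$ to the algebra $\mathbf{C}[x_1,\dots,x_n]/\langle q_1,\dots,q_k\rangle$ by a finite sequence of transformations of types (P1), (P2), (P3).
   Context: $\langle p_1,\dots,p_m\rangle$ denotes the ideal generated by $p_1,\dots,p_m$. For polynomials over $\mathbf{C}$, $V(p_1,\dots,p_m)$ denotes the algebraic variety $\{p_i=0,\ i=1,\dots,m\}$ in $\mathbf{C}^n$, considered as an affine scheme: $V(p_1,\dots,p_m)$ and $V(q_1,\dots,q_k)$ are called isomorphic if the algebras $\mathbf{C}[x_1,\dots,x_n]/\langle p_1,\dots,p_m\rangle$ and $\mathbf{C}[x_1,\dots,x_n]/\langle q_1,\dots,q_k\rangle$ are isomorphic (ideals are not replaced by their radicals). The transformations are applied to presented algebras of residue classes, i.e. to data consisting of a finite set of variables and an ideal $R$ of the polynomial algebra over $K$ in these variables: (P1) Introducing a new variable: replace $K[x_1,\dots,x_n]/R$ by $K[x_1,\dots,x_n,y]/(R+\langle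 y-p(x_1,\dots,x_n)\rangle)$, where $y$ is a new variable and $p\in K[x_1,\dots,x_n]$ is an arbitrary polynomial. (Here $R$ on the right means the ideal generated by $R$ in the larger polynomial algebra.) (P2) Canceling a variable (the converse of (P1)): replace an algebra of the form $K[x_1,\dots,x_n,y]/\langle p_1,\dots,p_m,q\rangle$, where $q=y-p(x_1,\dots,x_n)$ with $p\in K[x_1,\dots,x_n]$ and $p_1,\dots,p_m\in K[x_1,\dots,x_n]$, by $K[x_1,\dots,x_n]/\langle p_1,\dots,p_m\rangle$. (P3) Renaming the variables: replace the variables $(x_1,\dots,x_n)$ by $(x_{i_1},\dots,x_{i_n})$, where $i_1,\dots,i_n$ are arbitrary distinct indices, not necessarily in $\{1,\dots,n\}$ (and rewrite the ideal accordingly). Here the number of variables may vary along the sequence of transformations. *)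

theory Defs
  imports Complex_Main "HOL-Library.Poly_Mapping" "HOL-Algebra.QuotRing"
begin

text \<open>
  A monomial is a finitely supported exponent function, and a polynomial is a finitely supported
  function from monomials to coefficients. All polynomials live in one type whose variables are
  indexed by the natural numbers; for a set \<open>X\<close> of indices, the algebra \<open>K[x\<^sub>i | i \<in> X]\<close>
  is the subring \<open>mpoly_ring X\<close>. Presentations with different numbers of variables can
  therefore be related to each other.
\<close>

type_synonym 'a mpoly = "(nat \<Rightarrow>\<^sub>0 nat) \<Rightarrow>\<^sub>0 'a"

definition Var :: "nat \<Rightarrow> 'a::field mpoly" where
  "Var i = Poly_Mapping.single (Poly_Mapping.single i 1) 1"

definition Const :: "'a::field \<Rightarrow> 'a mpoly" where
  "Const c = Poly_Mapping.single 0 c"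

definition vars :: "'a::field mpoly \<Rightarrow> nat set" where
  "vars p = (\<Union>m\<in>Poly_Mapping.keys p. Poly_Mapping.keys m)"

definition mpoly_ring :: "nat set \<Rightarrow> 'a::field mpoly ring" where
  "mpoly_ring X =
     \<lparr>carrier = {p. vars p \<subseteq> X}, mult = (*), one = 1, zero = 0, add = (+)\<rparr>"

definition rename :: "(nat \<Rightarrow> nat) \<Rightarrow> 'a::field mpoly \<Rightarrow> 'a mpoly" where
  "rename \<sigma> p = (\<Sum>m\<in>Poly_Mapping.keys p.
     Const (Poly_Mapping.lookup p m) *
     (\<Prod>i\<in>Poly_Mapping.keys m. Var (\<sigma> i) ^ Poly_Mapping.lookup m i))"

text \<open>
  A presented algebra \<open>(X, R)\<close> consists of a set of variables and an ideal of \<open>mpoly_ring X\<close>;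
  it stands for the residue class algebra \<open>mpoly_ring X Quot R\<close>, whose \<open>K\<close>-algebra structure
  is given by the residue classes of the constants.
\<close>

type_synonym 'a presentation = "nat set \<times> 'a mpoly set"

definition residue_algebra :: "'a::field presentation \<Rightarrow> 'a mpoly set ring" where
  "residue_algebra A = mpoly_ring (fst A) Quot snd A"

definition scalar :: "'a::field presentation \<Rightarrow> 'a \<Rightarrow> 'a mpoly set" where
  "scalar A c = snd A +>\<^bsub>mpoly_ring (fst A)\<^esub> Const c"

definition algebras_isomorphic :: "'a::field presentation \<Rightarrow> 'a presentation \<Rightarrow> bool" where
  "algebras_isomorphic A B \<longleftrightarrow>
     (\<exists>\<phi>\<in>ring_iso (residue_algebra A) (residue_algebra B). \<forall>c. \<phi> (scalar A c) = scalar B c)"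

definition presented :: "nat set \<Rightarrow> 'a::field mpoly set \<Rightarrow> 'a presentation" where
  "presented X P = (X, genideal (mpoly_ring X) P)"

text \<open>
  In \<open>P3\<close>, \<open>rename \<sigma>\<close> is applied only to polynomials with variables in \<open>X\<close>, so the values of
  \<open>\<sigma>\<close> outside \<open>X\<close> play no role.
\<close>

inductive transformation :: "'a::field presentation \<Rightarrow> 'a presentation \<Rightarrow> bool" where
  P1: "finite X \<Longrightarrow> ideal R (mpoly_ring X) \<Longrightarrow> y \<notin> X \<Longrightarrow> p \<in> carrier (mpoly_ring X) \<Longrightarrow>
    transformation (X, R)
      (insert y X, genideal (mpoly_ring (insert y X)) R
         <+>\<^bsub>mpoly_ring (insert y X)\<^esub> genideal (mpoly_ring (insert y X)) {Var y - p})"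
| P2: "finite X \<Longrightarrow> finite P \<Longrightarrow> P \<subseteq> carrier (mpoly_ring X) \<Longrightarrow> y \<notin> X \<Longrightarrow>
    p \<in> carrier (mpoly_ring X) \<Longrightarrow>
    transformation (presented (insert y X) (P \<union> {Var y - p})) (presented X P)"
| P3: "finite X \<Longrightarrow> ideal R (mpoly_ring X) \<Longrightarrow> inj_on \<sigma> X \<Longrightarrow>
    transformation (X, R) (\<sigma> ` X, rename \<sigma> ` R)"

text \<open>
  The varieties in \<open>\<complex>\<^sup>n\<close> are affine schemes, given by the ideals generated by the defining
  polynomials (not by their radicals).
\<close>

definition varieties_isomorphic ::
  "nat \<Rightarrow> complex mpoly set \<Rightarrow> complex mpoly set \<Rightarrow> bool" where
  "varieties_isomorphic n P Q \<longleftrightarrow> algebras_isomorphic (presented {1..n} P) (presented {1..n} Q)"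

end

theory Submission
  imports Defs
begin

text \<open>
  Each transformation replaces an algebra by an isomorphic one: a variable \<open>y\<close> with the relation
  \<open>y = p(x)\<close> is redundant, and renaming is harmless. So presentations connected by transformations
  have isomorphic algebras.

  Conversely, let \<open>K[X]/\<langle>P\<rangle>\<close> and \<open>K[Y]/\<langle>Q\<rangle>\<close> be isomorphic, where the finite sets \<open>X\<close> and \<open>Y\<close>
  may be taken disjoint by (P3). Representatives of the images of the variables under the isomorphism and its inverse
  are polynomials \<open>s\<^sub>i \<in> K[Y]\<close> and \<open>t\<^sub>j \<in> K[X]\<close> (\<open>isomorphic_imp_mutually_inverse\<close>). In \<open>K[X \<union> Y]\<close> the
  two ideals
    \<open>\<langle>P, y\<^sub>j - t\<^sub>j (j \<in> Y)\<rangle>\<close> and \<open>\<langle>Q, x\<^sub>i - s\<^sub>i (i \<in> X)\<rangle>\<close>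
  coincide: both are the ideal of the graph of the isomorphism (\<open>graph_ideal_le\<close>). Starting from
  \<open>K[X]/\<langle>P\<rangle>\<close>, the variables \<open>y\<^sub>j\<close> are introduced by (P1) with the relations \<open>y\<^sub>j = t\<^sub>j\<close>; the result is
  also what (P1) produces from \<open>K[Y]/\<langle>Q\<rangle>\<close> with the relations \<open>x\<^sub>i = s\<^sub>i\<close>, so (P2) cancels the
  variables \<open>x\<^sub>i\<close> and leaves \<open>K[Y]/\<langle>Q\<rangle>\<close>.

  Homomorphisms are handled throughout as substitutions \<open>subst s\<close> on the type of all polynomials.
  The relation \<open>mutually_inverse\<close> expresses an isomorphism of residue class algebras by means of two
  substitutions, which turns all later arguments into computations with ideal membership.
\<close>

section \<open>Substitution\<close>

definition monomial_value :: "(nat \<Rightarrow> 'a::field mpoly) \<Rightarrow> (nat \<Rightarrow>\<^sub>0 nat) \<Rightarrow> 'a mpoly" where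
  "monomial_value s m = (\<Prod>i\<in>Poly_Mapping.keys m. s i ^ Poly_Mapping.lookup m i)"

text \<open>
  The values \<open>s i\<close> on a set \<open>X\<close> determine the homomorphism out of \<open>K[X]\<close>, so the domain \<open>X\<close> need
  not be part of the data; the renaming of variables is a special case.
\<close>

definition subst :: "(nat \<Rightarrow> 'a::field mpoly) \<Rightarrow> 'a mpoly \<Rightarrow> 'a mpoly" where
  "subst s p = (\<Sum>m\<in>Poly_Mapping.keys p. Const (Poly_Mapping.lookup p m) * monomial_value s m)"

lemma rename_eq_subst: "rename \<sigma> = subst (\<lambda>i. Var (\<sigma> i))"
  by (simp add: fun_eq_iff rename_def subst_def monomial_value_def)

lemma monomial_value_superset:
  assumes "finite A" "Poly_Mapping.keys m \<subseteq> A"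
  shows "monomial_value s m = (\<Prod>i\<in>A. s i ^ Poly_Mapping.lookup m i)"
  unfolding monomial_value_def
  by (rule prod.mono_neutral_left) (use assms in \<open>auto simp: in_keys_iff\<close>)

lemma monomial_value_add: "monomial_value s (m + m') = monomial_value s m * monomial_value s m'"
proof -
  let ?A = "Poly_Mapping.keys m \<union> Poly_Mapping.keys m'"
  have "monomial_value s (m + m') = (\<Prod>i\<in>?A. s i ^ Poly_Mapping.lookup (m + m') i)"
    by (rule monomial_value_superset) (simp_all add: keys_add)
  also have "\<dots> = monomial_value s m * monomial_value s m'"
    by (simp add: monomial_value_superset[where A = ?A] lookup_add power_add prod.distrib)
  finally show ?thesis .
qed

lemma Const_0 [simp]: "Const 0 = 0"
  by (simp add: Const_def)

lemma Const_1 [simp]: "Const 1 = 1"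
  by (simp add: Const_def)

lemma Const_add: "Const (a + b) = Const a + Const b"
  by (simp add: Const_def single_add)

lemma Const_mult: "Const (a * b) = Const a * Const b"
  by (simp add: Const_def mult_single)

lemma subst_superset:
  assumes "finite A" "Poly_Mapping.keys p \<subseteq> A"
  shows "subst s p = (\<Sum>m\<in>A. Const (Poly_Mapping.lookup p m) * monomial_value s m)"
  unfolding subst_def
  by (rule sum.mono_neutral_left) (use assms in \<open>auto simp: in_keys_iff\<close>)

lemma subst_add [simp]: "subst s (p + q) = subst s p + subst s q"
proof -
  let ?A = "Poly_Mapping.keys p \<union> Poly_Mapping.keys q"
  have "subst s (p + q)
      = (\<Sum>m\<in>?A. Const (Poly_Mapping.lookup (p + q) m) * monomial_value s m)"
    by (rule subst_superset) (simp_all add: keys_add)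
  also have "\<dots> = subst s p + subst s q"
    by (simp add: subst_superset[where A = ?A] lookup_add Const_add distrib_right sum.distrib)
  finally show ?thesis .
qed

lemma subst_0 [simp]: "subst s 0 = 0"
  by (simp add: subst_def)

lemma subst_single: "subst s (Poly_Mapping.single m c) = Const c * monomial_value s m"
  by (cases "c = 0") (simp_all add: subst_def)

lemma subst_Const [simp]: "subst s (Const c) = Const c"
  unfolding Const_def[of c] subst_single by (simp add: monomial_value_def Const_def)

lemma subst_1 [simp]: "subst s 1 = 1"
  using subst_Const[of s 1] by simp

lemma subst_Var [simp]: "subst s (Var i) = s i"
  by (simp add: Var_def subst_single monomial_value_def)

lemma subst_uminus [simp]: "subst s (- p) = - subst s p"
  using subst_add[of s "- p" p] by (simp add: eq_neg_iff_add_eq_0 del: subst_add)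

lemma subst_diff [simp]: "subst s (p - q) = subst s p - subst s q"
  using subst_add[of s p "- q"] by simp

lemma sum_of_monomials:
  fixes p :: "'a::field mpoly"
  shows "p =
    (\<Sum>m\<in>Poly_Mapping.keys p. Poly_Mapping.single m (Poly_Mapping.lookup p m))"
  by (rule poly_mapping_eqI) (simp add: lookup_sum lookup_single when_def in_keys_iff)

text \<open>
  Additive induction over the terms of \<open>p\<close>. The exponents stay restricted to those of \<open>p\<close>, which
  is what keeps the variables of \<open>p\<close> under control below.
\<close>

lemma monomial_induct [case_names single add zero]:
  fixes p :: "'a::field mpoly"
  assumes "\<And>m c. m \<in> Poly_Mapping.keys p \<Longrightarrow> P (Poly_Mapping.single m c)"
    and "\<And>q r. P q \<Longrightarrow> P r \<Longrightarrow> P (q + r)" "P 0"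
  shows "P p"
proof -
  have "P (\<Sum>m\<in>A. Poly_Mapping.single m (Poly_Mapping.lookup p m))"
    if "finite A" "A \<subseteq> Poly_Mapping.keys p" for A
    using that by (induction A rule: finite_induct) (auto intro: assms)
  from this[of "Poly_Mapping.keys p"] show ?thesis
    using sum_of_monomials[of p] by simp
qed

lemma subst_mult [simp]: "subst s (p * q) = subst s p * subst s q"
proof (rule monomial_induct[where p = p])
  show "subst s (Poly_Mapping.single m c * q) = subst s (Poly_Mapping.single m c) * subst s q" for m c
    by (rule monomial_induct[where p = q])
       (simp_all add: mult_single subst_single monomial_value_add Const_mult distrib_left)
qed (simp_all add: distrib_right)

lemma monomial_value_Var: "monomial_value Var m = Poly_Mapping.single m 1"
proof -
  have pw: "Var i ^ k = Poly_Mapping.single (Poly_Mapping.single i k) (1::'a)" for i k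
    by (induction k) (simp_all add: Var_def mult_single flip: single_add)
  have "(\<Prod>i\<in>A. Var i ^ Poly_Mapping.lookup m i)
      = Poly_Mapping.single (\<Sum>i\<in>A. Poly_Mapping.single i (Poly_Mapping.lookup m i)) (1::'a)"
    if "finite A" for A
    using that by (induction A rule: finite_induct) (simp_all add: pw mult_single)
  moreover have "(\<Sum>i\<in>Poly_Mapping.keys m. Poly_Mapping.single i (Poly_Mapping.lookup m i)) = m"
    by (rule poly_mapping_eqI) (simp add: lookup_sum lookup_single when_def in_keys_iff)
  ultimately show ?thesis
    by (simp add: monomial_value_def)
qed

section \<open>Polynomial rings and their ideals\<close>

lemma mpoly_ring_simps [simp]:
  "p \<in> carrier (mpoly_ring X) \<longleftrightarrow> vars p \<subseteq> X"
  "mult (mpoly_ring X) = (*)" "one (mpoly_ring X) = 1"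
  "zero (mpoly_ring X) = 0" "add (mpoly_ring X) = (+)"
  by (simp_all add: mpoly_ring_def)

lemma vars_Const [simp]: "vars (Const c) = {}"
  by (auto simp: vars_def Const_def)

lemma vars_0 [simp]: "vars 0 = {}"
  by (simp add: vars_def)

lemma vars_1 [simp]: "vars 1 = {}"
  using vars_Const[of 1] by simp

lemma vars_Var [simp]: "vars (Var i) = {i}"
  by (auto simp: vars_def Var_def)

lemma vars_add: "vars (p + q) \<subseteq> vars p \<union> vars q"
  using keys_add[of p q] by (auto simp: vars_def)

lemma vars_mult: "vars (p * q) \<subseteq> vars p \<union> vars q"
proof
  fix i assume "i \<in> vars (p * q)"
  then obtain a b where "a \<in> Poly_Mapping.keys p" "b \<in> Poly_Mapping.keys q" "i \<in> Poly_Mapping.keys (a + b)"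
    using keys_mult[of p q] by (fastforce simp: vars_def)
  then show "i \<in> vars p \<union> vars q"
    using keys_add[of a b] by (auto simp: vars_def)
qed

lemma vars_uminus [simp]: "vars (- p) = vars p"
  by (simp add: vars_def)

lemma vars_subset_intros [simp]:
  "vars p \<subseteq> X \<Longrightarrow> vars q \<subseteq> X \<Longrightarrow> vars (p + q) \<subseteq> X"
  "vars p \<subseteq> X \<Longrightarrow> vars q \<subseteq> X \<Longrightarrow> vars (p * q) \<subseteq> X"
  "vars p \<subseteq> X \<Longrightarrow> vars q \<subseteq> X \<Longrightarrow> vars (p - q) \<subseteq> X"
proof -
  show a: "vars (p + q) \<subseteq> X" "vars (p * q) \<subseteq> X" if "vars p \<subseteq> X" "vars q \<subseteq> X" for p q
    using that vars_add[of p q] vars_mult[of p q] by blast+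
  show "vars (p - q) \<subseteq> X" if "vars p \<subseteq> X" "vars q \<subseteq> X"
    using a(1)[of p "- q"] that by simp
qed

text \<open>
  \<open>K[X]\<close> is generated as a ring by the constants and the variables in \<open>X\<close>. Therefore
  homomorphisms out of \<open>K[X]\<close> can be compared on these generators.
\<close>

lemma mpoly_ring_induct [consumes 1, case_names Const Var add mult]:
  assumes "vars p \<subseteq> X"
    and Const: "\<And>c. P (Const c)"
    and Var: "\<And>i. i \<in> X \<Longrightarrow> P (Var i)"
    and add: "\<And>q r. vars q \<subseteq> X \<Longrightarrow> vars r \<subseteq> X \<Longrightarrow> P q \<Longrightarrow> P r \<Longrightarrow> P (q + r)"
    and mult: "\<And>q r. vars q \<subseteq> X \<Longrightarrow> vars r \<subseteq> X \<Longrightarrow> P q \<Longrightarrow> P r \<Longrightarrow> P (q * r)"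
  shows "P p"
proof -
  let ?Q = "\<lambda>q. vars q \<subseteq> X \<and> P q"
  have pow: "?Q (q ^ k)" if "?Q q" for q k
    using that Const[of 1] by (induction k) (auto simp: mult)
  have prd: "?Q (\<Prod>i\<in>A. f i)" if "finite A" "\<And>i. i \<in> A \<Longrightarrow> ?Q (f i)" for A and f :: "nat \<Rightarrow> _"
    using that Const[of 1] by (induction A rule: finite_induct) (auto intro: mult)
  have "?Q (Poly_Mapping.single m c)" if "m \<in> Poly_Mapping.keys p" for m c
  proof -
    have "Poly_Mapping.single m c = Const c * monomial_value Var m"
      by (simp add: monomial_value_Var Const_def mult_single)
    moreover have "Poly_Mapping.keys m \<subseteq> X"
      using that assms(1) by (auto simp: vars_def)
    then have "?Q (monomial_value Var m)"
      unfolding monomial_value_def by (intro prd pow) (auto simp: Var)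
    ultimately show ?thesis
      using Const[of c] by (auto intro: mult)
  qed
  then have "?Q p"
    by (rule monomial_induct[where p = p]) (use Const[of 0] in \<open>auto intro: add\<close>)
  then show ?thesis ..
qed

lemma vars_subst:
  assumes "vars p \<subseteq> X" "\<And>i. i \<in> X \<Longrightarrow> vars (s i) \<subseteq> Y"
  shows "vars (subst s p) \<subseteq> Y"
  using assms(1) by (induction p rule: mpoly_ring_induct) (auto dest: assms(2))

lemma subst_subst: "subst t (subst s p) = subst (\<lambda>i. subst t (s i)) p"
  using subset_UNIV[of "vars p"] by (induction p rule: mpoly_ring_induct) auto

lemma subst_ident: "vars p \<subseteq> X \<Longrightarrow> (\<And>i. i \<in> X \<Longrightarrow> s i = Var i) \<Longrightarrow> subst s p = p"
  by (induction p rule: mpoly_ring_induct) auto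

lemma cring_mpoly_ring: "cring (mpoly_ring X)"
proof (rule cringI)
  show "abelian_group (mpoly_ring X)"
  proof (rule abelian_groupI)
    fix p assume "p \<in> carrier (mpoly_ring X)"
    then show "\<exists>q\<in>carrier (mpoly_ring X). q \<oplus>\<^bsub>mpoly_ring X\<^esub> p = \<zero>\<^bsub>mpoly_ring X\<^esub>"
      by (intro bexI[of _ "- p"]) auto
  qed (auto simp: add_ac)
  show "comm_monoid (mpoly_ring X)"
    by (rule comm_monoidI) (auto simp: mult_ac)
qed (simp add: distrib_right)

lemma ring_mpoly_ring: "ring (mpoly_ring X)"
  using cring_mpoly_ring by (rule cring.axioms(1))

lemma a_inv_mpoly_ring: "vars p \<subseteq> X \<Longrightarrow> \<ominus>\<^bsub>mpoly_ring X\<^esub> p = - p"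
  using abelian_group.minus_equality[OF ring.is_abelian_group[OF ring_mpoly_ring[of X]], of "- p" p]
  by simp

lemma ideal_mpoly_ringI:
  assumes "\<And>p. p \<in> I \<Longrightarrow> vars p \<subseteq> X" "0 \<in> I"
    and "\<And>p q. p \<in> I \<Longrightarrow> q \<in> I \<Longrightarrow> p + q \<in> I"
    and "\<And>p q. p \<in> I \<Longrightarrow> vars q \<subseteq> X \<Longrightarrow> q * p \<in> I"
  shows "ideal I (mpoly_ring X)"
proof (rule idealI[OF ring_mpoly_ring])
  have inv: "inv\<^bsub>add_monoid (mpoly_ring X)\<^esub> p = - p" if "p \<in> I" for p
    using a_inv_mpoly_ring[of p X] assms(1)[OF that] by (simp add: a_inv_def)
  have neg: "- p \<in> I" if "p \<in> I" for p
    using assms(4)[OF that, of "- 1"] by simp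
  show "subgroup I (add_monoid (mpoly_ring X))"
    by unfold_locales (use assms inv neg in \<open>auto\<close>)
qed (use assms(4) in \<open>auto simp: mult.commute\<close>)

lemma ideal_mpoly_ringD:
  assumes "ideal I (mpoly_ring X)"
  shows "p \<in> I \<Longrightarrow> vars p \<subseteq> X" "0 \<in> I"
    and "p \<in> I \<Longrightarrow> q \<in> I \<Longrightarrow> p + q \<in> I" "p \<in> I \<Longrightarrow> q \<in> I \<Longrightarrow> p - q \<in> I"
    and "p \<in> I \<Longrightarrow> vars q \<subseteq> X \<Longrightarrow> q * p \<in> I" "p \<in> I \<Longrightarrow> vars q \<subseteq> X \<Longrightarrow> p * q \<in> I"
proof -
  interpret ideal I "mpoly_ring X" by fact
  show *: "p \<in> I \<Longrightarrow> vars p \<subseteq> X" for p using subsetD[OF a_subset, of p] by simp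
  show "0 \<in> I" using additive_subgroup.zero_closed[OF is_additive_subgroup] by simp
  show **: "p \<in> I \<Longrightarrow> q \<in> I \<Longrightarrow> p + q \<in> I" for p q
    using additive_subgroup.a_closed[OF is_additive_subgroup] by simp
  show m: "p \<in> I \<Longrightarrow> vars q \<subseteq> X \<Longrightarrow> q * p \<in> I" for p q using I_l_closed by simp
  then show "p \<in> I \<Longrightarrow> vars q \<subseteq> X \<Longrightarrow> p * q \<in> I" by (simp add: mult.commute)
  show "p - q \<in> I" if "p \<in> I" "q \<in> I"
    using **[OF that(1) m[OF that(2), of "-1"]] by simp
qed

lemma ideal_uminus_iff:
  assumes "ideal I (mpoly_ring X)"
  shows "p - q \<in> I \<longleftrightarrow> q - p \<in> I"
  using ideal_mpoly_ringD(4)[OF assms ideal_mpoly_ringD(2)[OF assms]] by (metis diff_0 minus_diff_eq)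

lemma coset_mpoly_ring: "I +>\<^bsub>mpoly_ring X\<^esub> p = (\<lambda>r. r + p) ` I"
  by (auto simp: a_r_coset_def')

lemma coset_eq_iff:
  assumes I: "ideal I (mpoly_ring X)"
  shows "I +>\<^bsub>mpoly_ring X\<^esub> p = I +>\<^bsub>mpoly_ring X\<^esub> q \<longleftrightarrow> p - q \<in> I"
proof
  assume "I +>\<^bsub>mpoly_ring X\<^esub> p = I +>\<^bsub>mpoly_ring X\<^esub> q"
  moreover have "p \<in> (\<lambda>r. r + p) ` I"
    using ideal_mpoly_ringD(2)[OF I] by force
  ultimately show "p - q \<in> I"
    by (auto simp: coset_mpoly_ring)
next
  assume d: "p - q \<in> I"
  have "(\<lambda>r. r + p) ` I \<subseteq> (\<lambda>r. r + q) ` I" if "p - q \<in> I" for p q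
  proof
    fix x assume "x \<in> (\<lambda>r. r + p) ` I"
    then obtain r where "r \<in> I" "x = (r + (p - q)) + q" by auto
    with that ideal_mpoly_ringD(3)[OF I] show "x \<in> (\<lambda>r. r + q) ` I" by blast
  qed
  from this[OF d] this[of q p] d show "I +>\<^bsub>mpoly_ring X\<^esub> p = I +>\<^bsub>mpoly_ring X\<^esub> q"
    using ideal_uminus_iff[OF I, of p q] by (simp add: coset_mpoly_ring subset_antisym)
qed

text \<open>
  Modulo an ideal, substituting congruent values gives congruent results: both substitutions become
  homomorphisms into the residue class ring that agree on the variables.
\<close>

lemma ideal_subst_cong:
  assumes I: "ideal I (mpoly_ring Z)"
    and p: "vars p \<subseteq> X"
    and st: "\<And>i. i \<in> X \<Longrightarrow> vars (s i) \<subseteq> Z" "\<And>i. i \<in> X \<Longrightarrow> vars (t i) \<subseteq> Z"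
      "\<And>i. i \<in> X \<Longrightarrow> s i - t i \<in> I"
  shows "subst s p - subst t p \<in> I"
  using p
proof (induction p rule: mpoly_ring_induct)
  case (add q r)
  then show ?case
    using ideal_mpoly_ringD(3)[OF I, of "subst s q - subst t q" "subst s r - subst t r"]
    by (simp add: algebra_simps)
next
  case (mult q r)
  have "subst s (q * r) - subst t (q * r)
      = subst s q * (subst s r - subst t r) + subst t r * (subst s q - subst t q)"
    by (simp add: algebra_simps)
  also have "\<dots> \<in> I"
    by (intro ideal_mpoly_ringD(3,5)[OF I] mult.IH vars_subst[OF mult.hyps(1)] vars_subst[OF mult.hyps(2)] st)
  finally show ?case .
qed (use ideal_mpoly_ringD(2)[OF I] st in auto)

lemma genideal_ideal: "P \<subseteq> carrier (mpoly_ring X) \<Longrightarrow> ideal (genideal (mpoly_ring X) P) (mpoly_ring X)"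
  using ring.genideal_ideal[OF ring_mpoly_ring] .

lemma genideal_self: "P \<subseteq> genideal (mpoly_ring X) P"
  by (auto simp: genideal_def)

lemma genideal_least: "ideal I (mpoly_ring X) \<Longrightarrow> P \<subseteq> I \<Longrightarrow> genideal (mpoly_ring X) P \<subseteq> I"
  by (auto simp: genideal_def)

lemma ideal_subst_vimage:
  fixes s :: "nat \<Rightarrow> 'a::field mpoly"
  assumes "ideal J (mpoly_ring Y)" "\<And>i. i \<in> X \<Longrightarrow> vars (s i) \<subseteq> Y"
  shows "ideal {p. vars p \<subseteq> X \<and> subst s p \<in> J} (mpoly_ring X)"
proof (rule ideal_mpoly_ringI)
  fix p q :: "'a mpoly"
  assume p: "p \<in> {p. vars p \<subseteq> X \<and> subst s p \<in> J}" and q: "vars q \<subseteq> X"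
  have "subst s q * subst s p \<in> J"
    using p by (intro ideal_mpoly_ringD(5)[OF assms(1)] vars_subst[OF q assms(2)]) auto
  with p q show "q * p \<in> {p. vars p \<subseteq> X \<and> subst s p \<in> J}"
    using vars_subset_intros(2) by auto
qed (use ideal_mpoly_ringD(2,3)[OF assms(1)] vars_subset_intros(1) in auto)

lemma genideal_ideal_eq: "ideal I (mpoly_ring X) \<Longrightarrow> genideal (mpoly_ring X) I = I"
  using genideal_self[of I X] genideal_least[of I X I] by blast

text \<open>
  Relations may be replaced by the ideal that they generate in a smaller polynomial ring. This
  translates between (P1), which speaks of ideals, and (P2), which speaks of finite sets of
  generators.
\<close>

lemma genideal_genideal_Un:
  assumes "X \<subseteq> Z" "P \<subseteq> carrier (mpoly_ring X)" "Q \<subseteq> carrier (mpoly_ring Z)"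
  shows "genideal (mpoly_ring Z) (genideal (mpoly_ring X) P \<union> Q) = genideal (mpoly_ring Z) (P \<union> Q)"
proof (rule subset_antisym)
  have sub: "P \<union> Q \<subseteq> carrier (mpoly_ring Z)"
    using assms by fastforce
  let ?J = "genideal (mpoly_ring Z) (P \<union> Q)"
  have J: "ideal ?J (mpoly_ring Z)"
    by (rule genideal_ideal[OF sub])
  \<comment> \<open>the contraction of \<open>J\<close> to \<open>K[X]\<close>, as the preimage under the inclusion \<open>subst Var\<close>\<close>
  have "ideal {p. vars p \<subseteq> X \<and> subst Var p \<in> ?J} (mpoly_ring X)"
    using assms(1) by (intro ideal_subst_vimage[OF J]) auto
  then have "genideal (mpoly_ring X) P \<subseteq> {p. vars p \<subseteq> X \<and> subst Var p \<in> ?J}"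
    by (rule genideal_least)
       (use assms(2) genideal_self[of "P \<union> Q"] in \<open>auto simp: subst_ident[OF subset_UNIV] mpoly_ring_def\<close>)
  then have "genideal (mpoly_ring X) P \<subseteq> ?J"
    by (auto simp: subst_ident[OF subset_UNIV])
  then show "genideal (mpoly_ring Z) (genideal (mpoly_ring X) P \<union> Q) \<subseteq> ?J"
    using genideal_self[of "P \<union> Q"] by (intro genideal_least[OF J]) auto
  have "genideal (mpoly_ring X) P \<union> Q \<subseteq> carrier (mpoly_ring Z)"
    using ideal_mpoly_ringD(1)[OF genideal_ideal[OF assms(2)]] assms(1,3) by fastforce
  then show "?J \<subseteq> genideal (mpoly_ring Z) (genideal (mpoly_ring X) P \<union> Q)"
    using genideal_self[of "genideal (mpoly_ring X) P \<union> Q" Z] genideal_self[of P X]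
    by (intro genideal_least genideal_ideal) blast+
qed

lemma genideal_set_add:
  assumes "P \<subseteq> carrier (mpoly_ring X)" "Q \<subseteq> carrier (mpoly_ring X)"
  shows "genideal (mpoly_ring X) P <+>\<^bsub>mpoly_ring X\<^esub> genideal (mpoly_ring X) Q
    = genideal (mpoly_ring X) (P \<union> Q)"
proof -
  have "genideal (mpoly_ring X) Q \<subseteq> carrier (mpoly_ring X)"
    using ideal_mpoly_ringD(1)[OF genideal_ideal[OF assms(2)]] by auto
  then show ?thesis
    using ring.union_genideal[OF ring_mpoly_ring genideal_ideal[OF assms(1)] genideal_ideal[OF assms(2)]]
      genideal_genideal_Un[OF subset_refl assms(1), of "genideal (mpoly_ring X) Q"]
      genideal_genideal_Un[OF subset_refl assms(2,1)] by (simp add: Un_commute)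
qed


section \<open>Isomorphisms as mutually inverse substitutions\<close>

text \<open>
  The explicit content of an isomorphism of presented algebras: substitutions that respect the
  relations and are inverse to each other modulo the relations.
\<close>

definition mutually_inverse ::
  "(nat \<Rightarrow> 'a::field mpoly) \<Rightarrow> (nat \<Rightarrow> 'a mpoly) \<Rightarrow> 'a presentation \<Rightarrow> 'a presentation \<Rightarrow> bool"
where
  "mutually_inverse s t A B \<longleftrightarrow>
     (\<forall>i\<in>fst A. vars (s i) \<subseteq> fst B) \<and> (\<forall>j\<in>fst B. vars (t j) \<subseteq> fst A) \<and>
     (\<forall>p\<in>snd A. subst s p \<in> snd B) \<and> (\<forall>q\<in>snd B. subst t q \<in> snd A) \<and>
     (\<forall>i\<in>fst A. subst t (s i) - Var i \<in> snd A) \<and> (\<forall>j\<in>fst B. subst s (t j) - Var j \<in> snd B)"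

lemma mutually_inverse_sym: "mutually_inverse s t A B \<longleftrightarrow> mutually_inverse t s B A"
  by (auto simp: mutually_inverse_def)

lemma mutually_inverse_subst_subst:
  assumes inv: "mutually_inverse s t (X, R) (Y, S)" and R: "ideal R (mpoly_ring X)"
    and p: "vars p \<subseteq> X"
  shows "subst t (subst s p) - p \<in> R"
proof -
  have "\<And>i. i \<in> X \<Longrightarrow> vars (s i) \<subseteq> Y" "\<And>j. j \<in> Y \<Longrightarrow> vars (t j) \<subseteq> X"
      "\<And>i. i \<in> X \<Longrightarrow> subst t (s i) - Var i \<in> R"
    using inv by (auto simp: mutually_inverse_def)
  then have "subst (\<lambda>i. subst t (s i)) p - subst Var p \<in> R"
    by (intro ideal_subst_cong[OF R p]) (simp_all add: vars_subst[of _ Y])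
  then show ?thesis
    by (simp add: subst_subst subst_ident[OF p])
qed

lemma algebras_isomorphic_refl: "algebras_isomorphic A A"
  unfolding algebras_isomorphic_def by (rule bexI[OF _ ring_iso_set_refl]) simp

lemma algebras_isomorphic_trans:
  assumes "algebras_isomorphic A B" "algebras_isomorphic B C"
  shows "algebras_isomorphic A C"
proof -
  obtain \<phi> \<psi> where \<phi>: "\<phi> \<in> ring_iso (residue_algebra A) (residue_algebra B)"
      "\<forall>c. \<phi> (scalar A c) = scalar B c"
    and \<psi>: "\<psi> \<in> ring_iso (residue_algebra B) (residue_algebra C)"
      "\<forall>c. \<psi> (scalar B c) = scalar C c"
    using assms unfolding algebras_isomorphic_def by blast
  then show ?thesis
    unfolding algebras_isomorphic_def
    by (intro bexI[of _ "\<psi> \<circ> \<phi>"] ring_iso_set_trans[OF \<phi>(1) \<psi>(1)]) simp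
qed

text \<open>
  The map \<open>p \<mapsto> S + s(p)\<close> from \<open>K[X]\<close> to \<open>K[Y]/S\<close> has kernel \<open>R\<close> and is onto, because \<open>t\<close> undoes \<open>s\<close>
  modulo \<open>R\<close> and \<open>s\<close> undoes \<open>t\<close> modulo \<open>S\<close>; the homomorphism theorem turns it into the isomorphism.
\<close>

lemma mutually_inverse_imp_isomorphic:
  assumes inv: "mutually_inverse s t (X, R) (Y, S)"
    and R: "ideal R (mpoly_ring X)" and S: "ideal S (mpoly_ring Y)"
  shows "algebras_isomorphic (X, R) (Y, S)"
proof -
  let ?K = "mpoly_ring X" and ?L = "mpoly_ring Y"
  let ?h = "\<lambda>p. S +>\<^bsub>?L\<^esub> subst s p"
  have s: "\<And>i. i \<in> X \<Longrightarrow> vars (s i) \<subseteq> Y" and t: "\<And>j. j \<in> Y \<Longrightarrow> vars (t j) \<subseteq> X"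
    using inv by (auto simp: mutually_inverse_def)
  have subst_hom: "subst s \<in> ring_hom ?K ?L"
    by (rule ring_hom_memI) (simp_all add: vars_subst[OF _ s])
  have hom: "?h \<in> ring_hom ?K (?L Quot S)"
    using ring_hom_trans[OF subst_hom ideal.rcos_ring_hom[OF S]] by (simp add: comp_def)
  interpret h: ring_hom_ring ?K "?L Quot S" ?h
    by (rule ring_hom_ringI2[OF ring_mpoly_ring ideal.quotient_is_ring[OF S] hom])
  have zero: "\<zero>\<^bsub>?L Quot S\<^esub> = S"
    by (simp add: FactRing_def)
  have S0: "S = S +>\<^bsub>?L\<^esub> 0"
    by (simp add: coset_mpoly_ring)
  have "?h p = S \<longleftrightarrow> p \<in> R" if p: "vars p \<subseteq> X" for p
  proof -
    have "?h p = S \<longleftrightarrow> subst s p \<in> S"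
      using coset_eq_iff[OF S, of "subst s p" 0] S0 by simp
    also have "\<dots> \<longleftrightarrow> p \<in> R"
    proof
      assume "subst s p \<in> S"
      then have "subst t (subst s p) \<in> R"
        using inv by (simp add: mutually_inverse_def)
      from ideal_mpoly_ringD(4)[OF R this mutually_inverse_subst_subst[OF inv R p]]
      show "p \<in> R" by simp
    qed (use inv in \<open>simp add: mutually_inverse_def\<close>)
    finally show ?thesis .
  qed
  then have "{p. vars p \<subseteq> X \<and> ?h p = S} = R"
    using ideal_mpoly_ringD(1)[OF R] by blast
  then have kernel: "a_kernel ?K (?L Quot S) ?h = R"
    unfolding a_kernel_def' zero mpoly_ring_simps .
  have "C \<in> ?h ` carrier ?K" if C: "C \<in> carrier (?L Quot S)" for C
  proof -
    obtain q where q: "vars q \<subseteq> Y" "C = S +>\<^bsub>?L\<^esub> q"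
      using C by (auto simp: FactRing_def A_RCOSETS_def')
    have "subst s (subst t q) - q \<in> S"
      using mutually_inverse_subst_subst[OF _ S q(1)] inv mutually_inverse_sym by blast
    then have "C = ?h (subst t q)"
      using coset_eq_iff[OF S] q(2) by metis
    moreover have "subst t q \<in> carrier ?K"
      using vars_subst[OF q(1) t] by simp
    ultimately show ?thesis
      by (rule image_eqI)
  qed
  then have surj: "?h ` carrier ?K = carrier (?L Quot S)"
    using h.hom_closed by blast
  have iso: "(\<lambda>C. the_elem (?h ` C)) \<in> ring_iso (?K Quot R) (?L Quot S)"
    using h.FactRing_iso_set[OF surj] unfolding kernel .
  have "the_elem (?h ` (R +>\<^bsub>?K\<^esub> Const c)) = S +>\<^bsub>?L\<^esub> Const c" for c
    using h.the_elem_simp[of "Const c"] unfolding kernel by simp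
  then show ?thesis
    unfolding algebras_isomorphic_def residue_algebra_def scalar_def fst_conv snd_conv
    by (intro bexI[OF _ iso] allI)
qed

text \<open>
  A homomorphism of residue class algebras lifts to a substitution: choose for \<open>s i\<close> a representative
  of the image of the class of the variable \<open>i\<close>.
\<close>

lemma quotient_hom_is_subst:
  assumes R: "ideal R (mpoly_ring X)" and S: "ideal S (mpoly_ring Y)"
    and hom: "\<phi> \<in> ring_hom (mpoly_ring X Quot R) (mpoly_ring Y Quot S)"
    and scalar: "\<And>c. \<phi> (R +>\<^bsub>mpoly_ring X\<^esub> Const c) = S +>\<^bsub>mpoly_ring Y\<^esub> Const c"
  obtains s where "\<And>i. i \<in> X \<Longrightarrow> vars (s i) \<subseteq> Y"
    and "\<And>p. vars p \<subseteq> X \<Longrightarrow> \<phi> (R +>\<^bsub>mpoly_ring X\<^esub> p) = S +>\<^bsub>mpoly_ring Y\<^esub> subst s p"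
proof -
  let ?K = "mpoly_ring X" and ?L = "mpoly_ring Y"
  have "\<exists>q. vars q \<subseteq> Y \<and> \<phi> (R +>\<^bsub>?K\<^esub> Var i) = S +>\<^bsub>?L\<^esub> q" if "i \<in> X" for i
  proof -
    have "R +>\<^bsub>?K\<^esub> Var i \<in> carrier (?K Quot R)"
      using that ring_hom_closed[OF ideal.rcos_ring_hom[OF R], of "Var i"] by simp
    from ring_hom_closed[OF hom this]
    obtain q where "vars q \<subseteq> Y" "\<phi> (R +>\<^bsub>?K\<^esub> Var i) = S +>\<^bsub>?L\<^esub> q"
      by (auto simp: FactRing_def A_RCOSETS_def')
    then show ?thesis by blast
  qed
  then obtain s where s: "vars (s i) \<subseteq> Y" "\<phi> (R +>\<^bsub>?K\<^esub> Var i) = S +>\<^bsub>?L\<^esub> s i" if "i \<in> X" for i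
    by metis
  note KR = ring_hom_add[OF ideal.rcos_ring_hom[OF R]] ring_hom_mult[OF ideal.rcos_ring_hom[OF R]]
    ring_hom_closed[OF ideal.rcos_ring_hom[OF R]]
  note LS = ring_hom_add[OF ideal.rcos_ring_hom[OF S]] ring_hom_mult[OF ideal.rcos_ring_hom[OF S]]
  have "\<phi> (R +>\<^bsub>?K\<^esub> p) = S +>\<^bsub>?L\<^esub> subst s p" if "vars p \<subseteq> X" for p
    using that
  proof (induction p rule: mpoly_ring_induct)
    case (add q r)
    then show ?case
      using KR(1,3)[of q] KR(3)[of r] LS(1)[of "subst s q" "subst s r"] ring_hom_add[OF hom]
        vars_subst[OF _ s(1)] by simp
  next
    case (mult q r)
    then show ?case
      using KR(2,3)[of q] KR(3)[of r] LS(2)[of "subst s q" "subst s r"] ring_hom_mult[OF hom]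
        vars_subst[OF _ s(1)] by simp
  qed (simp_all add: scalar s(2))
  with s(1) that show ?thesis by blast
qed

lemma isomorphic_imp_mutually_inverse:
  assumes iso: "algebras_isomorphic (X, R) (Y, S)"
    and R: "ideal R (mpoly_ring X)" and S: "ideal S (mpoly_ring Y)"
  obtains s t where "mutually_inverse s t (X, R) (Y, S)"
proof -
  let ?K = "mpoly_ring X" and ?L = "mpoly_ring Y"
  obtain \<phi> where \<phi>: "\<phi> \<in> ring_iso (?K Quot R) (?L Quot S)"
    and \<phi>c: "\<And>c. \<phi> (R +>\<^bsub>?K\<^esub> Const c) = S +>\<^bsub>?L\<^esub> Const c"
    using iso by (auto simp: algebras_isomorphic_def residue_algebra_def scalar_def)
  define \<psi> where "\<psi> = inv_into (carrier (?K Quot R)) \<phi>"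
  have \<psi>: "\<psi> \<in> ring_iso (?L Quot S) (?K Quot R)"
    unfolding \<psi>_def by (rule ring_iso_set_sym[OF ideal.quotient_is_ring[OF R] \<phi>])
  have bij: "bij_betw \<phi> (carrier (?K Quot R)) (carrier (?L Quot S))"
    using \<phi> by (simp add: ring_iso_def)
  have KR: "R +>\<^bsub>?K\<^esub> p \<in> carrier (?K Quot R)" if "vars p \<subseteq> X" for p
    using ring_hom_closed[OF ideal.rcos_ring_hom[OF R], of p] that by simp
  have LS: "S +>\<^bsub>?L\<^esub> q \<in> carrier (?L Quot S)" if "vars q \<subseteq> Y" for q
    using ring_hom_closed[OF ideal.rcos_ring_hom[OF S], of q] that by simp
  have \<psi>\<phi>: "\<psi> (\<phi> (R +>\<^bsub>?K\<^esub> p)) = R +>\<^bsub>?K\<^esub> p" if "vars p \<subseteq> X" for p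
    unfolding \<psi>_def using bij_betw_inv_into_left[OF bij KR[OF that]] .
  have \<phi>\<psi>: "\<phi> (\<psi> (S +>\<^bsub>?L\<^esub> q)) = S +>\<^bsub>?L\<^esub> q" if "vars q \<subseteq> Y" for q
    unfolding \<psi>_def using bij_betw_inv_into_right[OF bij LS[OF that]] .
  have \<psi>c: "\<psi> (S +>\<^bsub>?L\<^esub> Const c) = R +>\<^bsub>?K\<^esub> Const c" for c
    using \<psi>\<phi>[of "Const c"] \<phi>c[of c] by simp
  obtain s where s: "\<And>i. i \<in> X \<Longrightarrow> vars (s i) \<subseteq> Y"
      "\<And>p. vars p \<subseteq> X \<Longrightarrow> \<phi> (R +>\<^bsub>?K\<^esub> p) = S +>\<^bsub>?L\<^esub> subst s p"
    using quotient_hom_is_subst[OF R S _ \<phi>c] \<phi> by (auto simp: ring_iso_def)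
  obtain t where t: "\<And>j. j \<in> Y \<Longrightarrow> vars (t j) \<subseteq> X"
      "\<And>q. vars q \<subseteq> Y \<Longrightarrow> \<psi> (S +>\<^bsub>?L\<^esub> q) = R +>\<^bsub>?K\<^esub> subst t q"
    using quotient_hom_is_subst[OF S R _ \<psi>c] \<psi> by (auto simp: ring_iso_def)
  have "subst s p \<in> S" if "p \<in> R" for p
    using s(2)[OF ideal_mpoly_ringD(1)[OF R that]] s(2)[of 0] that
      coset_eq_iff[OF R, of p 0] coset_eq_iff[OF S, of "subst s p" 0] by simp
  moreover have "subst t q \<in> R" if "q \<in> S" for q
    using t(2)[OF ideal_mpoly_ringD(1)[OF S that]] t(2)[of 0] that
      coset_eq_iff[OF S, of q 0] coset_eq_iff[OF R, of "subst t q" 0] by simp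
  moreover have "subst t (s i) - Var i \<in> R" if "i \<in> X" for i
    using \<psi>\<phi>[of "Var i"] s(2)[of "Var i"] t(2)[OF s(1)[OF that]] that
    by (simp flip: coset_eq_iff[OF R])
  moreover have "subst s (t j) - Var j \<in> S" if "j \<in> Y" for j
    using \<phi>\<psi>[of "Var j"] t(2)[of "Var j"] s(2)[OF t(1)[OF that]] that
    by (simp flip: coset_eq_iff[OF S])
  ultimately show ?thesis
    using s(1) t(1) by (intro that[of s t]) (simp add: mutually_inverse_def)
qed

section \<open>Transformations preserve the isomorphism class\<close>

text \<open>
  The new variable is redundant, since substituting \<open>p\<close> for \<open>y\<close> kills the only new relation. This is
  the reason why (P1) and (P2) do not change the algebra.
\<close>

lemma adjoin_variable_mutually_inverse:
  fixes p :: "'a::field mpoly"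
  assumes R: "ideal R (mpoly_ring X)" and y: "y \<notin> X" and p: "vars p \<subseteq> X"
  shows "mutually_inverse Var (Var(y := p)) (X, R)
    (insert y X, genideal (mpoly_ring (insert y X)) (R \<union> {Var y - p}))"
proof -
  let ?t = "Var(y := p)"
  let ?J = "genideal (mpoly_ring (insert y X)) (R \<union> {Var y - p})"
  have sub: "R \<union> {Var y - p} \<subseteq> carrier (mpoly_ring (insert y X))"
    using subset_insertI2[OF ideal_mpoly_ringD(1)[OF R]] subset_insertI2[OF p]
    by (auto simp del: subset_insert_iff)
  note J = genideal_ideal[OF sub]
  have fix_X: "subst ?t r = r" if "vars r \<subseteq> X" for r
    using that y by (intro subst_ident) auto
  have "ideal {q. vars q \<subseteq> insert y X \<and> subst ?t q \<in> R} (mpoly_ring (insert y X))"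
    using p by (intro ideal_subst_vimage[OF R]) auto
  then have "?J \<subseteq> {q. vars q \<subseteq> insert y X \<and> subst ?t q \<in> R}"
    by (rule genideal_least)
       (use sub ideal_mpoly_ringD(1,2)[OF R] fix_X p in auto)
  then have "\<forall>q\<in>?J. subst ?t q \<in> R"
    by blast
  moreover have "R \<subseteq> ?J" "Var y - p \<in> ?J"
    using genideal_self[of "R \<union> {Var y - p}"] by auto
  moreover have "subst Var q = q" for q :: "'a mpoly"
    by (rule subst_ident[OF subset_UNIV]) simp
  ultimately show ?thesis
    using p y ideal_mpoly_ringD(2)[OF R] ideal_mpoly_ringD(2)[OF J] ideal_uminus_iff[OF J, of p "Var y"]
    by (auto simp: mutually_inverse_def simp del: fun_upd_apply simp: fun_upd_def)
qed

text \<open>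
  An injective renaming is an isomorphism of polynomial rings, inverted by the renaming along
  \<open>inv_into X \<sigma>\<close>, and hence carries generated ideals to generated ideals.
\<close>

lemma rename_genideal:
  fixes P :: "'a::field mpoly set"
  assumes P: "P \<subseteq> carrier (mpoly_ring X)" and inj: "inj_on \<sigma> X"
  shows "rename \<sigma> ` genideal (mpoly_ring X) P = genideal (mpoly_ring (\<sigma> ` X)) (rename \<sigma> ` P)"
    and "ideal (genideal (mpoly_ring (\<sigma> ` X)) (rename \<sigma> ` P)) (mpoly_ring (\<sigma> ` X))"
proof -
  let ?s = "\<lambda>i. Var (\<sigma> i)" and ?t = "\<lambda>j. Var (inv_into X \<sigma> j)"
  let ?I = "genideal (mpoly_ring X) P" and ?J = "genideal (mpoly_ring (\<sigma> ` X)) (rename \<sigma> ` P)"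
  have s: "vars (?s i) \<subseteq> \<sigma> ` X" if "i \<in> X" for i using that by simp
  have t: "vars (?t j) \<subseteq> X" if "j \<in> \<sigma> ` X" for j using that inv_into_into[OF that] by simp
  have ts: "subst ?t (subst ?s p) = p" if "vars p \<subseteq> X" for p :: "'a mpoly"
    unfolding subst_subst using that inj by (intro subst_ident) auto
  have st: "subst ?s (subst ?t q) = q" if "vars q \<subseteq> \<sigma> ` X" for q :: "'a mpoly"
    unfolding subst_subst using that by (intro subst_ident) (auto simp: f_inv_into_f)
  have I: "ideal ?I (mpoly_ring X)" by (rule genideal_ideal[OF P])
  show J: "ideal ?J (mpoly_ring (\<sigma> ` X))"
  proof (intro genideal_ideal subsetI)
    fix q assume "q \<in> rename \<sigma> ` P"
    then obtain p where "vars p \<subseteq> X" "q = subst ?s p"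
      using P by (auto simp: rename_eq_subst subset_iff[of P])
    then show "q \<in> carrier (mpoly_ring (\<sigma> ` X))"
      using vars_subst[OF _ s] by simp
  qed
  have "?I \<subseteq> {p. vars p \<subseteq> X \<and> subst ?s p \<in> ?J}"
  proof (intro genideal_least ideal_subst_vimage[OF J s] subsetI)
    fix p assume "p \<in> P"
    then show "p \<in> {p. vars p \<subseteq> X \<and> subst ?s p \<in> ?J}"
      using subsetD[OF P] subsetD[OF genideal_self[of "rename \<sigma> ` P"], of "rename \<sigma> p"]
      by (simp add: rename_eq_subst)
  qed
  moreover have "?J \<subseteq> {q. vars q \<subseteq> \<sigma> ` X \<and> subst ?t q \<in> ?I}"
  proof (intro genideal_least ideal_subst_vimage[OF I t] subsetI)
    fix q assume "q \<in> rename \<sigma> ` P"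
    then obtain p where "p \<in> P" "vars p \<subseteq> X" "q = subst ?s p"
      using P by (auto simp: rename_eq_subst subset_iff[of P])
    then show "q \<in> {q. vars q \<subseteq> \<sigma> ` X \<and> subst ?t q \<in> ?I}"
      using subsetD[OF genideal_self[of P]] ts vars_subst[of p X ?s, OF _ s] by simp
  qed
  ultimately show "rename \<sigma> ` ?I = ?J"
    using st by (force simp: rename_eq_subst)
qed

lemma mutually_inverse_imp_both_isomorphic:
  assumes "mutually_inverse s t (X, R) (Y, S)"
    and "ideal R (mpoly_ring X)" "ideal S (mpoly_ring Y)"
  shows "algebras_isomorphic (X, R) (Y, S) \<and> algebras_isomorphic (Y, S) (X, R)"
  using mutually_inverse_imp_isomorphic[OF _ assms(2,3)] mutually_inverse_imp_isomorphic[OF _ assms(3,2)]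
    assms(1) mutually_inverse_sym by blast

lemma genideal_adjoin_variable:
  assumes P: "P \<subseteq> carrier (mpoly_ring X)" and p: "vars p \<subseteq> X"
  shows "genideal (mpoly_ring (insert y X)) (genideal (mpoly_ring X) P)
      <+>\<^bsub>mpoly_ring (insert y X)\<^esub> genideal (mpoly_ring (insert y X)) {Var y - p}
    = genideal (mpoly_ring (insert y X)) (P \<union> {Var y - p})"
proof -
  have "vars (Var y - p) \<subseteq> insert y X"
    using p by (intro vars_subset_intros) auto
  moreover have "genideal (mpoly_ring X) P \<subseteq> carrier (mpoly_ring (insert y X))"
    using subset_insertI2[OF ideal_mpoly_ringD(1)[OF genideal_ideal[OF P]]] by auto
  ultimately show ?thesis
    using genideal_genideal_Un[of X "insert y X" P "{Var y - p}"] P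
    by (simp add: genideal_set_add subset_insertI)
qed

lemma adjoin_variable_isomorphic:
  assumes R: "ideal R (mpoly_ring X)" and y: "y \<notin> X" and p: "vars p \<subseteq> X"
  defines "J \<equiv> genideal (mpoly_ring (insert y X)) (R \<union> {Var y - p})"
  shows "algebras_isomorphic (X, R) (insert y X, J) \<and> algebras_isomorphic (insert y X, J) (X, R)"
proof -
  have "R \<union> {Var y - p} \<subseteq> carrier (mpoly_ring (insert y X))"
    using subset_insertI2[OF ideal_mpoly_ringD(1)[OF R]] subset_insertI2[OF p]
    by (auto simp del: subset_insert_iff)
  then show ?thesis
    unfolding J_def using genideal_ideal adjoin_variable_mutually_inverse[OF R y p] R
    by (intro mutually_inverse_imp_both_isomorphic)
qed

lemma rename_isomorphic:
  assumes R: "ideal R (mpoly_ring X)" and inj: "inj_on \<sigma> X"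
  shows "algebras_isomorphic (X, R) (\<sigma> ` X, rename \<sigma> ` R)"
proof -
  let ?s = "\<lambda>i. Var (\<sigma> i)" and ?t = "\<lambda>j. Var (inv_into X \<sigma> j)"
  have P: "R \<subseteq> carrier (mpoly_ring X)"
    using ideal_mpoly_ringD(1)[OF R] by auto
  have S: "ideal (rename \<sigma> ` R) (mpoly_ring (\<sigma> ` X))"
    using rename_genideal[OF P inj] genideal_ideal_eq[OF R] by simp
  have "subst ?t (subst ?s r) = r" if "r \<in> R" for r
    unfolding subst_subst using inj ideal_mpoly_ringD(1)[OF R that] by (intro subst_ident[of _ X]) auto
  then have "mutually_inverse ?s ?t (X, R) (\<sigma> ` X, rename \<sigma> ` R)"
    using inj ideal_mpoly_ringD(2)[OF R] ideal_mpoly_ringD(2)[OF S]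
    by (auto simp: mutually_inverse_def rename_eq_subst)
  then show ?thesis
    by (rule mutually_inverse_imp_isomorphic[OF _ R S])
qed

lemma transformation_imp_isomorphic: "transformation A B \<Longrightarrow> algebras_isomorphic A B"
proof (induction rule: transformation.induct)
  case (P1 X R y p)
  have "R \<subseteq> carrier (mpoly_ring X)"
    using ideal_mpoly_ringD(1)[OF P1(2)] by auto
  from genideal_adjoin_variable[OF this, of p y] P1 show ?case
    using adjoin_variable_isomorphic[OF P1(2,3), of p] by (simp add: genideal_ideal_eq)
next
  case (P2 X P y p)
  have "genideal (mpoly_ring (insert y X)) (genideal (mpoly_ring X) P \<union> {Var y - p})
      = genideal (mpoly_ring (insert y X)) (P \<union> {Var y - p})"
    using P2 subset_insertI2[of "vars p" X y]
    by (intro genideal_genideal_Un) (auto simp del: subset_insert_iff)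
  then show ?case
    using adjoin_variable_isomorphic[OF genideal_ideal[OF P2(3)] P2(4), of p] P2(5)
    by (simp add: presented_def)
next
  case (P3 X R \<sigma>)
  then show ?case by (intro rename_isomorphic)
qed

lemma transformations_imp_isomorphic: "transformation\<^sup>*\<^sup>* A B \<Longrightarrow> algebras_isomorphic A B"
  by (induction rule: rtranclp_induct)
     (auto intro: algebras_isomorphic_refl algebras_isomorphic_trans transformation_imp_isomorphic)

section \<open>Isomorphic algebras are connected by transformations\<close>

text \<open>
  Since no \<open>t j\<close> involves variables from \<open>Y\<close>, the variables can be adjoined one at a time in any order.
  Each step is an instance of (P1) and its reverse an instance of (P2).
\<close>

lemma adjoin_variables:
  assumes fin: "finite Y" "finite X" "finite P" and P: "P \<subseteq> carrier (mpoly_ring X)"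
    and disj: "X \<inter> Y = {}" and t: "\<And>j. j \<in> Y \<Longrightarrow> vars (t j) \<subseteq> X"
  defines "B \<equiv> presented (X \<union> Y) (P \<union> (\<lambda>j. Var j - t j) ` Y)"
  shows "transformation\<^sup>*\<^sup>* (presented X P) B \<and> transformation\<^sup>*\<^sup>* B (presented X P)"
  using fin(1) disj t unfolding B_def
proof (induction Y rule: finite_induct)
  case empty
  then show ?case by simp
next
  case (insert y Y)
  let ?Z = "X \<union> Y" and ?Q = "P \<union> (\<lambda>j. Var j - t j) ` Y"
  have vars_eqn: "vars (Var j - t j) \<subseteq> ?Z" if "j \<in> Y" for j
    using insert.prems(2)[of j] that by (intro vars_subset_intros) auto
  have Q: "?Q \<subseteq> carrier (mpoly_ring ?Z)"
    using vars_eqn P by fastforce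
  have ty: "vars (t y) \<subseteq> ?Z" "y \<notin> ?Z" "finite ?Z" "finite ?Q"
    using insert.prems insert.hyps fin by auto
  have eq: "presented (X \<union> insert y Y) (P \<union> (\<lambda>j. Var j - t j) ` insert y Y)
      = presented (insert y ?Z) (?Q \<union> {Var y - t y})"
    by (simp add: insert_commute)
  have "transformation (presented ?Z ?Q) (presented (insert y ?Z) (?Q \<union> {Var y - t y}))"
    using transformation.P1[OF ty(3) genideal_ideal[OF Q] ty(2), of "t y"] ty(1)
    unfolding genideal_adjoin_variable[OF Q ty(1)] by (simp add: presented_def)
  moreover have "transformation (presented (insert y ?Z) (?Q \<union> {Var y - t y})) (presented ?Z ?Q)"
    using transformation.P2[OF ty(3,4) Q ty(2)] ty(1) by simp
  ultimately show ?case
    unfolding eq using insert.IH insert.prems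
    by (auto intro: rtranclp.rtrancl_into_rtrancl converse_rtranclp_into_rtranclp)
qed

text \<open>
  Let \<open>I\<close> be the ideal on the right. Modulo \<open>I\<close> each \<open>y\<^sub>j\<close> equals \<open>t\<^sub>j\<close>, so a polynomial in the variables \<open>Y\<close>
  may be replaced by its image under \<open>t\<close>. This image lies in \<open>\<langle>P\<rangle>\<close> for the elements of \<open>Q\<close>, and for
  \<open>s\<^sub>i\<close> it is congruent to \<open>x\<^sub>i\<close> modulo \<open>\<langle>P\<rangle>\<close>. So all generators on the left vanish modulo \<open>I\<close>.
\<close>

lemma graph_ideal_le:
  assumes inv: "mutually_inverse s t (presented X P) (presented Y Q)"
    and P: "P \<subseteq> carrier (mpoly_ring X)" and Q: "Q \<subseteq> carrier (mpoly_ring Y)"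
  shows "genideal (mpoly_ring (X \<union> Y)) (Q \<union> (\<lambda>i. Var i - s i) ` X)
    \<subseteq> genideal (mpoly_ring (X \<union> Y)) (P \<union> (\<lambda>j. Var j - t j) ` Y)"
proof -
  let ?G = "P \<union> (\<lambda>j. Var j - t j) ` Y"
  let ?I = "genideal (mpoly_ring (X \<union> Y)) ?G"
  have s: "\<And>i. i \<in> X \<Longrightarrow> vars (s i) \<subseteq> Y" and t: "\<And>j. j \<in> Y \<Longrightarrow> vars (t j) \<subseteq> X"
    and tQ: "\<And>q. q \<in> genideal (mpoly_ring Y) Q \<Longrightarrow> subst t q \<in> genideal (mpoly_ring X) P"
    and ts: "\<And>i. i \<in> X \<Longrightarrow> subst t (s i) - Var i \<in> genideal (mpoly_ring X) P"
    using inv by (auto simp: mutually_inverse_def presented_def)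
  have eqn: "(\<lambda>j. Var j - t j) ` Y \<subseteq> carrier (mpoly_ring (X \<union> Y))"
    using le_supI1[OF t] by (auto intro!: vars_subset_intros)
  have G: "?G \<subseteq> carrier (mpoly_ring (X \<union> Y))"
    using P eqn by fastforce
  note I = genideal_ideal[OF G]
  have le: "genideal (mpoly_ring X) P \<subseteq> ?I"
    using genideal_genideal_Un[OF Un_upper1 P eqn] genideal_self by blast
  have cong: "q - subst t q \<in> ?I" if "vars q \<subseteq> Y" for q
  proof -
    have "subst Var q - subst t q \<in> ?I"
      using genideal_self[of ?G "X \<union> Y"] le_supI1[OF t]
      by (intro ideal_subst_cong[OF I that]) auto
    then show ?thesis
      by (simp add: subst_ident[OF subset_UNIV])
  qed
  have "q \<in> ?I" if "q \<in> Q" for q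
  proof -
    have "subst t q \<in> ?I"
      using tQ genideal_self[of Q Y] le that by blast
    moreover have "vars q \<subseteq> Y"
      using subsetD[OF Q that] by simp
    ultimately show ?thesis
      using ideal_mpoly_ringD(3)[OF I cong, of q "subst t q"] by simp
  qed
  moreover have "Var i - s i \<in> ?I" if "i \<in> X" for i
  proof -
    have "s i - Var i \<in> ?I"
      using ideal_mpoly_ringD(3)[OF I cong[OF s[OF that]] subsetD[OF le ts[OF that]]] by simp
    then show ?thesis
      using ideal_uminus_iff[OF I] by blast
  qed
  ultimately show ?thesis
    by (intro genideal_least[OF I]) auto
qed

text \<open>
  Both presentations extend to the same presentation on \<open>X \<union> Y\<close>, because \<open>graph_ideal_le\<close> applies in
  both directions. Disjointness of \<open>X\<close> and \<open>Y\<close> makes the variables of one side new for the other.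
\<close>

lemma mutually_inverse_imp_transformations:
  assumes inv: "mutually_inverse s t (presented X P) (presented Y Q)"
    and P: "finite X" "finite P" "P \<subseteq> carrier (mpoly_ring X)"
    and Q: "finite Y" "finite Q" "Q \<subseteq> carrier (mpoly_ring Y)"
    and disj: "X \<inter> Y = {}"
  shows "transformation\<^sup>*\<^sup>* (presented X P) (presented Y Q)"
proof -
  have s: "\<And>i. i \<in> X \<Longrightarrow> vars (s i) \<subseteq> Y" and t: "\<And>j. j \<in> Y \<Longrightarrow> vars (t j) \<subseteq> X"
    using inv by (auto simp: mutually_inverse_def presented_def)
  have "transformation\<^sup>*\<^sup>* (presented X P) (presented (X \<union> Y) (P \<union> (\<lambda>j. Var j - t j) ` Y))"
    using adjoin_variables[where t = t, OF Q(1) P disj t] by blast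
  also have "presented (X \<union> Y) (P \<union> (\<lambda>j. Var j - t j) ` Y)
      = presented (Y \<union> X) (Q \<union> (\<lambda>i. Var i - s i) ` X)"
    using graph_ideal_le[OF inv P(3) Q(3)] inv[unfolded mutually_inverse_sym[of s]]
      graph_ideal_le[OF _ Q(3) P(3), of t s]
    by (simp add: presented_def Un_commute subset_antisym)
  also have "transformation\<^sup>*\<^sup>* \<dots> (presented Y Q)"
    using adjoin_variables[where t = s, OF P(1) Q _ s] disj by blast
  finally show ?thesis .
qed

lemma rename_transformation:
  assumes "finite X" "P \<subseteq> carrier (mpoly_ring X)" "inj_on \<sigma> X"
  shows "transformation (presented X P) (presented (\<sigma> ` X) (rename \<sigma> ` P))"
  using transformation.P3[OF assms(1) genideal_ideal[OF assms(2)] assms(3)]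
  by (simp add: presented_def rename_genideal(1)[OF assms(2,3)])

text \<open>
  For the forward direction, the variables of the second presentation are first shifted by a bound \<open>N\<close>
  of \<open>X\<close> to make the two sets of variables disjoint; a final (P3) shifts them back.
\<close>

theorem isomorphic_iff_transformations:
  assumes P: "finite X" "finite P" "P \<subseteq> carrier (mpoly_ring X)"
    and Q: "finite Y" "finite Q" "Q \<subseteq> carrier (mpoly_ring Y)"
  shows "algebras_isomorphic (presented X P) (presented Y Q)
    \<longleftrightarrow> transformation\<^sup>*\<^sup>* (presented X P) (presented Y Q)"
proof
  assume iso: "algebras_isomorphic (presented X P) (presented Y Q)"
  obtain N where N: "\<forall>i\<in>X. i < N"
    using P(1) finite_nat_set_iff_bounded by blast
  define \<sigma> \<tau> :: "nat \<Rightarrow> nat" where "\<sigma> i = i + N" and "\<tau> j = j - N" for i j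
  let ?Y = "\<sigma> ` Y" and ?Q = "rename \<sigma> ` Q"
  have inj: "inj_on \<sigma> Y" "inj_on \<tau> ?Y"
    by (auto simp: inj_on_def \<sigma>_def \<tau>_def)
  have vars_rename: "vars (rename \<sigma> q) \<subseteq> ?Y" "rename \<tau> (rename \<sigma> q) = q" if "q \<in> Q" for q
  proof -
    have "vars q \<subseteq> Y" using subsetD[OF Q(3) that] by simp
    then show "vars (rename \<sigma> q) \<subseteq> ?Y"
      unfolding rename_eq_subst by (rule vars_subst) simp
    show "rename \<tau> (rename \<sigma> q) = q"
      by (simp add: rename_eq_subst subst_subst \<sigma>_def \<tau>_def subst_ident[OF subset_UNIV])
  qed
  have Q': "?Q \<subseteq> carrier (mpoly_ring ?Y)" "finite ?Y" "finite ?Q"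
    using vars_rename(1) Q by (simp_all add: image_subset_iff)
  have "algebras_isomorphic (presented X P) (presented ?Y ?Q)"
    using iso transformation_imp_isomorphic[OF rename_transformation[OF Q(1,3) inj(1)]]
    by (rule algebras_isomorphic_trans)
  then obtain s t where "mutually_inverse s t (presented X P) (presented ?Y ?Q)"
    using isomorphic_imp_mutually_inverse[OF _ genideal_ideal[OF P(3)] genideal_ideal[OF Q'(1)]]
    unfolding presented_def by blast
  moreover have "X \<inter> ?Y = {}"
    using N by (auto simp: \<sigma>_def)
  ultimately have "transformation\<^sup>*\<^sup>* (presented X P) (presented ?Y ?Q)"
    using P Q' by (intro mutually_inverse_imp_transformations)
  also have "transformation (presented ?Y ?Q) (presented (\<tau> ` ?Y) (rename \<tau> ` ?Q))"
    by (rule rename_transformation[OF Q'(2,1) inj(2)])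
  also have "presented (\<tau> ` ?Y) (rename \<tau> ` ?Q) = presented Y Q"
  proof -
    have "\<tau> ` ?Y = Y"
      by (simp add: image_image \<sigma>_def \<tau>_def)
    moreover have "rename \<tau> ` ?Q = Q"
      using vars_rename(2) by (simp add: image_image)
    ultimately show ?thesis by simp
  qed
  finally show "transformation\<^sup>*\<^sup>* (presented X P) (presented Y Q)" .
qed (rule transformations_imp_isomorphic)

theorem theorem1p1:
  fixes n m k :: nat
    and p q :: "nat \<Rightarrow> 'a::field mpoly"
    and f g :: "nat \<Rightarrow> complex mpoly"
  shows "((\<forall>i\<in>{1..m}. p i \<in> carrier (mpoly_ring {1..n})) \<longrightarrow>
          (\<forall>j\<in>{1..k}. q j \<in> carrier (mpoly_ring {1..n})) \<longrightarrow>
          (algebras_isomorphic (presented {1..n} (p ` {1..m})) (presented {1..n} (q ` {1..k})) \<longleftrightarrow>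
           transformation\<^sup>*\<^sup>* (presented {1..n} (p ` {1..m})) (presented {1..n} (q ` {1..k}))))
       \<and> ((\<forall>i\<in>{1..m}. f i \<in> carrier (mpoly_ring {1..n})) \<longrightarrow>
          (\<forall>j\<in>{1..k}. g j \<in> carrier (mpoly_ring {1..n})) \<longrightarrow>
          (varieties_isomorphic n (f ` {1..m}) (g ` {1..k}) \<longleftrightarrow>
           transformation\<^sup>*\<^sup>* (presented {1..n} (f ` {1..m})) (presented {1..n} (g ` {1..k}))))"
  unfolding varieties_isomorphic_def
  by (intro conjI impI isomorphic_iff_transformations finite_atLeastAtMost finite_imageI image_subsetI)
     blast+

end
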